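(* Let $A$ be an $A_\varepsilon$-type set. Then $A$ is countably $1$-rectifiable if and only if $\mathcal{H}^1(\Lambda_\infty^{-1})=0$.
   Context: A set $M\subset\mathbb{R}^2$ is countably $1$-rectifiable if $M\subset M_0\cup\bigcup_{j=1}^\infty F_j(\mathbb{R})$ with $\mathcal{H}^1(M_0)=0$ and $F_j:\mathbb{R}\to\mathbb{R}^2$ Lipschitz. A triangular cap on a segment is a closed solid isosceles triangle having that segment as base; its base angle is either of its two equal angles. $A_\varepsilon$-type sets: let $A_{0,1}\subset\mathbb{R}^2$ be a segment of finite positive length, and $T_{0,1}$ a triangular cap on it of height $\varepsilon\mathcal{H}^1(A_{0,1})$ with $0<\varepsilon<1/100$ and base angle $\theta_0$. Let $\theta_0\ge\theta_1\ge\theta_2\ge\cdots$ be positive angles. Inductively, given caps $T_{n,i}$ on segments $A_{n,i}$, all with base angle $\theta_n$ ($1\le i\le2^n$), let $A_{n+1,2i-1},A_{n+1,2i}$ be the two edges of $T_{n,i}$ other than its base, numbered so that $A_{n+1,1},\dots,A_{n+1,2^{n+1}}$ are consecutive segments of a polygonal curve joining the end points of $A_{0,1}$ (always starting from the same end point), and for $k\in\{2i-1,2i\}$ let $T_{n+1,k}\subset T_{n,i}$ be the triangular cap on $A_{n+1,k}$ with base angle $\theta_{n+1}$. Let $B=\bigcap_{n=0}^\infty\bigcup_{i=1}^{2^n}T_{n,i}$ and let $E(B)$ be the set of all vertices of all $T_{n,i}$. An $A_\varepsilon$-type set is any set $A\in\{B,B\setminus E(B)\}$ arising in this way. Parametrisation: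 let $D_{n,1},\dots,D_{n,2^n}$ be the $2^n$ consecutive closed subsegments of $A_{0,1}$ of equal length (numbered from the same end point), and $F_n:A_{0,1}\to\mathbb{R}^2$ the continuous map taking each $D_{n,i}$ affinely onto $A_{n,i}$ in the order-preserving way. The limit $\mathcal{F}=\lim_{n\to\infty}F_n$ exists pointwise and is a bijection of $A_{0,1}$ onto $B$. For every $x\in A$ let $\tilde\Pi(x)=\prod_{n=0}^\infty(\cos\theta_n)^{-1}\in[1,\infty]$ (independent of $x$ here). Set $\Lambda_\infty=\{x\in A:\tilde\Pi(x)=\infty\}$ and $\Lambda_\infty^{-1}=\mathcal{F}^{-1}(\Lambda_\infty)\subset A_{0,1}$. *)

theory Defs
  imports "HOL-Analysis.Analysis"
begin

text \<open>One-dimensional Hausdorff (outer) measure. The boundedness condition on the covering sets is needed because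
  the library's real-valued \<^const>\<open>diameter\<close> is unspecified on unbounded sets.\<close>

definition hausdorff1_pre :: "real \<Rightarrow> 'a::metric_space set \<Rightarrow> ennreal" where
  "hausdorff1_pre \<delta> S =
     (INF C \<in> {C :: nat \<Rightarrow> 'a set. S \<subseteq> (\<Union>j. C j) \<and> (\<forall>j. bounded (C j) \<and> diameter (C j) \<le> \<delta>)}.
        \<Sum>j. ennreal (diameter (C j)))"

definition hausdorff1 :: "'a::metric_space set \<Rightarrow> ennreal" where
  "hausdorff1 S = (SUP \<delta>\<in>{0<..}. hausdorff1_pre \<delta> S)"

definition countably_1_rectifiable :: "(real^2) set \<Rightarrow> bool" where
  "countably_1_rectifiable M \<longleftrightarrow>
     (\<exists>M0 (F :: nat \<Rightarrow> real \<Rightarrow> real^2).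
        hausdorff1 M0 = 0 \<and> (\<forall>j. \<exists>L. L-lipschitz_on UNIV (F j)) \<and>
        M \<subseteq> M0 \<union> (\<Union>j. range (F j)))"

definition angle_between :: "real^2 \<Rightarrow> real^2 \<Rightarrow> real" where
  "angle_between u v = arccos (u \<bullet> v / (norm u * norm v))"

text \<open>\<open>c\<close> is the apex of a (non-degenerate) triangular cap on the segment from \<open>p\<close> to \<open>q\<close>
  with base angle \<open>\<alpha>\<close>; the cap itself is then \<open>convex hull {p, q, c}\<close>.\<close>

definition cap_apex :: "real^2 \<Rightarrow> real^2 \<Rightarrow> real \<Rightarrow> real^2 \<Rightarrow> bool" where
  "cap_apex p q \<alpha> c \<longleftrightarrow>
     \<not> collinear {p, q, c} \<and> dist p c = dist q c \<and> angle_between (q - p) (c - p) = \<alpha>"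

text \<open>The construction is recorded by the vertices \<open>P n 0, \<dots>, P n (2 ^ n)\<close> of the \<open>n\<close>-th polygonal
  curve, in order, always starting from the same end point \<open>P 0 0\<close>. Segments and caps are
  numbered from \<open>0\<close> to \<open>2 ^ n - 1\<close>, so the two edges of the \<open>i\<close>-th cap become the segments
  number \<open>2 * i\<close> and \<open>2 * i + 1\<close>, and the apex of the \<open>i\<close>-th cap is the vertex
  \<open>P (Suc n) (2 * i + 1)\<close>. Values \<open>P n i\<close> with \<open>i > 2 ^ n\<close> play no role.\<close>

definition seg :: "(nat \<Rightarrow> nat \<Rightarrow> real^2) \<Rightarrow> nat \<Rightarrow> nat \<Rightarrow> (real^2) set" where
  "seg P n i = closed_segment (P n i) (P n (Suc i))"

definition cap :: "(nat \<Rightarrow> nat \<Rightarrow> real^2) \<Rightarrow> nat \<Rightarrow> nat \<Rightarrow> (real^2) set" where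
  "cap P n i = convex hull {P n i, P n (Suc i), P (Suc n) (2 * i + 1)}"

text \<open>The height of the isosceles triangle \<open>cap P 0 0\<close> is the distance of its apex \<open>P 1 1\<close> from the
  midpoint of its base.\<close>

definition A_eps_construction ::
    "real \<Rightarrow> (nat \<Rightarrow> real) \<Rightarrow> (nat \<Rightarrow> nat \<Rightarrow> real^2) \<Rightarrow> bool" where
  "A_eps_construction \<epsilon> \<theta> P \<longleftrightarrow>
     0 < \<epsilon> \<and> \<epsilon> < 1 / 100 \<and>
     (\<forall>n. 0 < \<theta> n \<and> \<theta> (Suc n) \<le> \<theta> n) \<and>
     P 0 0 \<noteq> P 0 1 \<and>
     ennreal (dist (P 1 1) (midpoint (P 0 0) (P 0 1))) = ennreal \<epsilon> * hausdorff1 (seg P 0 0) \<and>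
     (\<forall>n. \<forall>i<2 ^ n.
        cap_apex (P n i) (P n (Suc i)) (\<theta> n) (P (Suc n) (2 * i + 1)) \<and>
        P (Suc n) (2 * i) = P n i \<and>
        P (Suc n) (2 * i + 2) = P n (Suc i) \<and>
        cap P (Suc n) (2 * i) \<subseteq> cap P n i \<and>
        cap P (Suc n) (2 * i + 1) \<subseteq> cap P n i)"

definition limit_set :: "(nat \<Rightarrow> nat \<Rightarrow> real^2) \<Rightarrow> (real^2) set" where
  "limit_set P = (\<Inter>n. \<Union>i<2 ^ n. cap P n i)"

definition vertex_set :: "(nat \<Rightarrow> nat \<Rightarrow> real^2) \<Rightarrow> (real^2) set" where
  "vertex_set P = (\<Union>n. \<Union>i<2 ^ n. {P n i, P n (Suc i), P (Suc n) (2 * i + 1)})"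

text \<open>For \<open>x = P 0 0 + t (P 0 1 - P 0 0)\<close> with \<open>t \<in> [0, 1]\<close>, the number \<open>s\<close> below is \<open>2 ^ n * t\<close>: its
  integer part is the index of the subsegment of \<open>A\<^bsub>0,1\<^esub>\<close> containing \<open>x\<close> and its fractional part
  the position of \<open>x\<close> in that subsegment. For \<open>t = 1\<close> the value is the end point \<open>P n (2 ^ n)\<close>.
  The lemma \<open>param_on_subsegment\<close> below characterises the map.\<close>

definition param :: "(nat \<Rightarrow> nat \<Rightarrow> real^2) \<Rightarrow> nat \<Rightarrow> real^2 \<Rightarrow> real^2" where
  "param P n x =
     (let s = 2 ^ n * (dist (P 0 0) x / dist (P 0 0) (P 0 1)); i = nat \<lfloor>s\<rfloor>
      in P n i + (s - real i) *\<^sub>R (P n (Suc i) - P n i))"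

definition limit_param :: "(nat \<Rightarrow> nat \<Rightarrow> real^2) \<Rightarrow> real^2 \<Rightarrow> real^2" where
  "limit_param P x = lim (\<lambda>n. param P n x)"

definition Pi_tilde :: "(nat \<Rightarrow> real) \<Rightarrow> real^2 \<Rightarrow> ennreal" where
  "Pi_tilde \<theta> x = lim (\<lambda>N. \<Prod>n<N. ennreal (inverse (cos (\<theta> n))))"

definition Lambda_inf :: "(nat \<Rightarrow> real) \<Rightarrow> (real^2) set \<Rightarrow> (real^2) set" where
  "Lambda_inf \<theta> A = {x \<in> A. Pi_tilde \<theta> x = \<infinity>}"

definition Lambda_inf_inv ::
    "(nat \<Rightarrow> real) \<Rightarrow> (nat \<Rightarrow> nat \<Rightarrow> real^2) \<Rightarrow> (real^2) set \<Rightarrow> (real^2) set" where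
  "Lambda_inf_inv \<theta> P A = {x \<in> seg P 0 0. limit_param P x \<in> Lambda_inf \<theta> A}"

lemma param_on_subsegment:
  fixes P :: "nat \<Rightarrow> nat \<Rightarrow> real^2" and n i :: nat and u :: real
  defines "D \<equiv> \<lambda>j::nat. P 0 0 + (real j / 2 ^ n) *\<^sub>R (P 0 1 - P 0 0)"
  assumes ne: "P 0 0 \<noteq> P 0 1" and u: "0 \<le> u" "u \<le> 1"
  shows "param P n ((1 - u) *\<^sub>R D i + u *\<^sub>R D (Suc i)) = (1 - u) *\<^sub>R P n i + u *\<^sub>R P n (Suc i)"
proof -
  define x where "x = (1 - u) *\<^sub>R D i + u *\<^sub>R D (Suc i)"
  have x: "x = P 0 0 + ((real i + u) / 2 ^ n) *\<^sub>R (P 0 1 - P 0 0)"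
    by (simp add: x_def D_def vec_eq_iff field_simps)
  have d: "dist (P 0 0) x = (real i + u) / 2 ^ n * dist (P 0 0) (P 0 1)"
    using u by (simp add: x dist_norm norm_minus_commute)
  have s: "2 ^ n * (dist (P 0 0) x / dist (P 0 0) (P 0 1)) = real i + u"
    using ne by (simp add: d)
  have "param P n x =
      P n (nat \<lfloor>real i + u\<rfloor>) + (real i + u - real (nat \<lfloor>real i + u\<rfloor>)) *\<^sub>R
        (P n (Suc (nat \<lfloor>real i + u\<rfloor>)) - P n (nat \<lfloor>real i + u\<rfloor>))"
    by (simp only: param_def Let_def s)
  also have "\<dots> = (1 - u) *\<^sub>R P n i + u *\<^sub>R P n (Suc i)"
  proof (cases "u = 1")
    case True
    then have "nat \<lfloor>real i + u\<rfloor> = Suc i" by linarith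
    then show ?thesis using True by simp
  next
    case False
    then have "nat \<lfloor>real i + u\<rfloor> = i" using u by linarith
    then show ?thesis by (simp add: algebra_simps)
  qed
  finally show ?thesis by (simp only: x_def)
qed

end

theory Submission
  imports Defs
begin

text \<open>Since \<open>\<theta>\<close> does not depend on the point, \<open>\<Lambda>\<^sub>\<infinity>\<close> is either empty or all of \<open>A\<close>. The segments of stage \<open>n\<close>
  have length \<open>|A\<^bsub>0,1\<^esub>| \<Pi>\<^sub>n / 2\<^sup>n\<close>, where \<open>\<Pi>\<^sub>n\<close> is the \<open>n\<close>-th partial product. If the \<open>\<Pi>\<^sub>n\<close> are
  bounded, the limit parametrisation is Lipschitz and its range contains \<open>A\<close>.

  Suppose they are unbounded. Two sibling caps lie in opposite cones with the common vertex as apex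
  and the base of their parent as axis, so points of non-neighbouring caps of stage \<open>n\<close> are at least a
  quarter of the segment length apart. Hence the inverse of the limit parametrisation has arbitrarily
  small local Lipschitz constant, and the preimage of every set of finite length is Lebesgue null.
  The preimage of a rectifiable set is then null, whereas that of \<open>A\<close> is \<open>[0,1]\<close> up to a countable set.\<close>

section \<open>Hausdorff measure: Lipschitz images and Lebesgue null preimages\<close>

text \<open>Cutting the interval into \<open>N\<close> equal pieces gives images of diameter at most
  \<open>L * h\<close>, which is at most \<open>\<delta>\<close> for large \<open>N\<close>, while
  the total \<open>N * (L * h)\<close> equals \<open>L * (b - a)\<close> for every
  \<open>\<delta>\<close>.\<close>

lemma hausdorff1_lipschitz_image_le:
  fixes F :: "real \<Rightarrow> 'a::metric_space"
  assumes F: "L-lipschitz_on {a..b} F" and ab: "a \<le> b"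
  shows "hausdorff1 (F ` {a..b}) \<le> ennreal (L * (b - a))"
  unfolding hausdorff1_def
proof (rule SUP_least)
  fix \<delta> :: real assume "\<delta> \<in> {0<..}"
  then have \<delta>: "\<delta> > 0" by simp
  have L: "L \<ge> 0" using F by (rule lipschitz_on_nonneg)
  obtain N :: nat where N: "L * (b - a) / \<delta> < real N" using reals_Archimedean2 by blast
  have N0: "N > 0" using N L ab \<delta> by (smt (verit) divide_nonneg_pos gr0I mult_nonneg_nonneg of_nat_0)
  define h where "h = (b - a) / real N"
  have h: "h \<ge> 0" "h * real N = b - a" using ab N0 by (auto simp: h_def)
  have Lh: "L * h \<le> \<delta>"
    using N \<delta> N0 by (simp add: h_def field_simps)
  \<comment> \<open>Coverings are sequences, so the finite family is padded with empty sets of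
    diameter 0.\<close>
  define C where "C j = (if j < N then F ` {a + real j * h..a + real (Suc j) * h} else {})" for j
  have sub: "{a + real j * h..a + real (Suc j) * h} \<subseteq> {a..b}" if "j < N" for j
  proof -
    have "real (Suc j) * h \<le> real N * h" using that h(1) by (intro mult_right_mono) auto
    then show ?thesis using h by (auto simp: mult.commute intro: order_trans[of _ "a + real j * h"])
  qed
  have dC: "dist x y \<le> L * h" if "x \<in> C j" "y \<in> C j" for x y j
  proof -
    from that have j: "j < N" by (auto simp: C_def split: if_splits)
    with that obtain s t where st: "x = F s" "y = F t"
      "s \<in> {a + real j * h..a + real (Suc j) * h}" "t \<in> {a + real j * h..a + real (Suc j) * h}"
      by (auto simp: C_def)
    have "dist x y \<le> L * dist s t"
      using lipschitz_onD[OF F] sub[OF j] st by blast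
    also have "\<dots> \<le> L * h"
      using L st(3,4) by (intro mult_left_mono) (auto simp: dist_real_def algebra_simps)
    finally show ?thesis .
  qed
  have bC: "bounded (C j)" for j
    unfolding bounded_two_points using dC by blast
  have diamC: "diameter (C j) \<le> (if j < N then L * h else 0)" for j
  proof (cases "j < N")
    case True
    then show ?thesis
      using dC[of _ j] L h by (auto simp: diameter_def intro!: cSUP_least)
  qed (simp add: C_def)
  have cov: "F ` {a..b} \<subseteq> (\<Union>j. C j)"
  proof clarify
    fix t assume t: "t \<in> {a..b}"
    show "F t \<in> (\<Union>j. C j)"
    proof (cases "t = b")
      case True
      \<comment> \<open>At the right end point the floor formula of the other case can return
        \<open>N\<close>, where \<open>C\<close> is empty; the last piece is taken instead.\<close>
      have "a + real (N - 1) * h \<le> b" "b \<le> a + real (Suc (N - 1)) * h"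
        using N0 h by (auto simp: of_nat_diff algebra_simps)
      then have "F t \<in> C (N - 1)" using N0 True by (auto simp: C_def simp del: of_nat_Suc)
      then show ?thesis by blast
    next
      case False
      then have tb: "t < b" "a \<le> t" using t by auto
      then have h0: "h > 0" using h N0 by (metis diff_gt_0_iff_gt less_le_trans le_less_trans mult_zero_left order_le_less)
      define j where "j = nat \<lfloor>(t - a) / h\<rfloor>"
      have j: "real j \<le> (t - a) / h" "(t - a) / h < real j + 1"
        using tb h0 unfolding j_def by (auto simp: of_nat_nat)
      have j': "real j * h \<le> t - a" "t - a \<le> (real j + 1) * h"
        using j h0 by (auto simp: field_simps)
      have "real j * h < real N * h" using j' tb h by (simp add: mult.commute)
      then have "j < N" using h0 by simp
      then have "F t \<in> C j" using j' by (auto simp: C_def algebra_simps)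
      then show ?thesis by blast
    qed
  qed
  have "hausdorff1_pre \<delta> (F ` {a..b}) \<le> (\<Sum>j. ennreal (diameter (C j)))"
    unfolding hausdorff1_pre_def
  proof (rule INF_lower, intro CollectI conjI allI)
    fix j show "diameter (C j) \<le> \<delta>" using diamC[of j] Lh \<delta> by (auto split: if_splits)
  qed (use cov bC in auto)
  also have "\<dots> = (\<Sum>j<N. ennreal (diameter (C j)))"
    by (rule suminf_finite) (auto simp: C_def)
  also have "\<dots> \<le> (\<Sum>j<N. ennreal (L * h))"
    using diamC by (intro sum_mono ennreal_leI) (metis lessThan_iff)
  also have "\<dots> = ennreal (L * (b - a))"
    using L h(1) by (simp add: ennreal_of_nat_eq_real_of_nat mult.left_commute mult.commute flip: ennreal_mult' h(2))
  finally show "hausdorff1_pre \<delta> (F ` {a..b}) \<le> ennreal (L * (b - a))" .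
qed

lemma hausdorff1_empty: "hausdorff1 {} = 0"
proof -
  have "hausdorff1_pre \<delta> ({} :: 'a set) \<le> 0" if "\<delta> > 0" for \<delta>
    unfolding hausdorff1_pre_def
    by (rule INF_lower2[of "\<lambda>_. {}"]) (use that in auto)
  then show ?thesis unfolding hausdorff1_def
    by (metis (no_types, lifting) SUP_least greaterThan_iff le_zero_eq)
qed

text \<open>The hypothesis on \<open>g\<close> says that its inverse is locally \<open>K\<close>-Lipschitz, uniformly in the point.\<close>

lemma lebesgue_cover_vimage:
  fixes g :: "real \<Rightarrow> 'a::metric_space"
  assumes g: "\<And>s t. s \<in> I \<Longrightarrow> t \<in> I \<Longrightarrow> dist (g s) (g t) < \<delta> \<Longrightarrow> dist s t \<le> K * dist (g s) (g t)"
    and \<delta>: "\<delta> > 0" and K: "K \<ge> 0" and S: "hausdorff1 S < ennreal h"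
  obtains T where "{t \<in> I. g t \<in> S} \<subseteq> T" "T \<in> lmeasurable" "measure lebesgue T \<le> 2 * K * h"
proof -
  \<comment> \<open>Halving \<open>\<delta>\<close> turns the non-strict bound on diameters into the
    strict inequality under which \<open>g\<close> can be applied.\<close>
  have "hausdorff1_pre (\<delta>/2) S \<le> hausdorff1 S"
    unfolding hausdorff1_def using \<delta> by (intro SUP_upper) auto
  then have "hausdorff1_pre (\<delta>/2) S < ennreal h" using S by (rule le_less_trans)
  then obtain C where C: "S \<subseteq> (\<Union>j. C j)" "\<And>j. bounded (C j)" "\<And>j. diameter (C j) \<le> \<delta>/2"
    and sumC: "(\<Sum>j. ennreal (diameter (C j))) < ennreal h"
    unfolding hausdorff1_pre_def INF_less_iff by blast
  have h0: "h \<ge> 0" using S by (metis ennreal_neg leI linorder_not_less order_less_imp_le not_less_zero)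
  have "\<exists>T. T \<in> sets lebesgue \<and> {t \<in> I. g t \<in> C j} \<subseteq> T \<and>
         emeasure lebesgue T \<le> ennreal (2 * K) * ennreal (diameter (C j))" for j
  proof (cases "{t \<in> I. g t \<in> C j} = {}")
    case False
    then obtain t0 where t0: "t0 \<in> I" "g t0 \<in> C j" by blast
    \<comment> \<open>Around one point of the preimage, an interval of radius \<open>r\<close>
      contains all the others; its length \<open>2 * r\<close> is the source of the factor
      2.\<close>
    define r where "r = K * diameter (C j)"
    have r: "r \<ge> 0" using K C(2) by (simp add: r_def diameter_ge_0)
    have "t \<in> {t0 - r..t0 + r}" if t: "t \<in> I" "g t \<in> C j" for t
    proof -
      have d: "dist (g t) (g t0) \<le> diameter (C j)"
        using diameter_bounded_bound[OF C(2) t(2) t0(2)] .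
      then have "dist (g t) (g t0) < \<delta>" using C(3)[of j] \<delta> by linarith
      then have "dist t t0 \<le> K * dist (g t) (g t0)" using g t t0 by blast
      also have "\<dots> \<le> r" unfolding r_def using d K by (rule mult_left_mono)
      finally show ?thesis by (auto simp: dist_real_def)
    qed
    moreover have "emeasure lebesgue {t0 - r..t0 + r} = ennreal (2 * K) * ennreal (diameter (C j))"
      using r K by (simp add: r_def flip: ennreal_mult')
    ultimately show ?thesis by (intro exI[of _ "{t0 - r..t0 + r}"]) auto
  qed (auto intro!: exI[of _ "{}"])
  then obtain T where T: "\<And>j. T j \<in> sets lebesgue" "\<And>j. {t \<in> I. g t \<in> C j} \<subseteq> T j"
     "\<And>j. emeasure lebesgue (T j) \<le> ennreal (2 * K) * ennreal (diameter (C j))"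
    by metis
  have "emeasure lebesgue (\<Union>j. T j) \<le> (\<Sum>j. emeasure lebesgue (T j))"
    using T(1) by (intro emeasure_subadditive_countably) auto
  also have "\<dots> \<le> (\<Sum>j. ennreal (2 * K) * ennreal (diameter (C j)))"
    using T(3) by (intro suminf_le) auto
  also have "\<dots> = ennreal (2 * K) * (\<Sum>j. ennreal (diameter (C j)))" by simp
  also have "\<dots> \<le> ennreal (2 * K) * ennreal h" using sumC by (intro mult_left_mono) auto
  also have "\<dots> = ennreal (2 * K * h)" using K h0 by (simp flip: ennreal_mult)
  finally have em: "emeasure lebesgue (\<Union>j. T j) \<le> ennreal (2 * K * h)" .
  show ?thesis
  proof
    show "{t \<in> I. g t \<in> S} \<subseteq> (\<Union>j. T j)" using C(1) T(2) by blast
    show "(\<Union>j. T j) \<in> lmeasurable"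
      using em T(1) by (intro fmeasurableI) (auto simp: less_top[symmetric] top_unique)
    show "measure lebesgue (\<Union>j. T j) \<le> 2 * K * h"
      using em K h0 by (simp add: measure_def enn2real_leI)
  qed
qed

text \<open>A null set lies below every positive bound, so a single fixed \<open>K\<close> suffices.
  This carries null sets from the segment to the parameter interval.\<close>

lemma negligible_vimage_null:
  fixes g :: "real \<Rightarrow> 'a::metric_space"
  assumes g: "\<And>s t. s \<in> I \<Longrightarrow> t \<in> I \<Longrightarrow> dist s t \<le> K * dist (g s) (g t)"
    and K: "K > 0" and S: "hausdorff1 S = 0"
  shows "negligible {t \<in> I. g t \<in> S}"
  unfolding negligible_outer_le
proof (intro allI impI)
  fix e :: real assume e: "e > 0"
  have "hausdorff1 S < ennreal (e / (2 * K))" using S e K by simp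
  from lebesgue_cover_vimage[OF g zero_less_one less_imp_le[OF K] this]
  obtain T where "{t \<in> I. g t \<in> S} \<subseteq> T" "T \<in> lmeasurable" "measure lebesgue T \<le> 2 * K * (e / (2 * K))"
    by blast
  then show "\<exists>T. {t \<in> I. g t \<in> S} \<subseteq> T \<and> T \<in> lmeasurable \<and> measure lebesgue T \<le> e" using K by auto
qed

text \<open>The preimage is covered by a set of measure roughly \<open>2 * K\<close> times the
  length of \<open>S\<close>. Here \<open>K\<close> may be made arbitrarily small, so finite length
  takes over the role of length 0.\<close>

lemma negligible_vimage_finite:
  fixes g :: "real \<Rightarrow> 'a::metric_space"
  assumes g: "\<And>e. e > 0 \<Longrightarrow> \<exists>\<delta>>0. \<forall>s\<in>I. \<forall>t\<in>I. dist (g s) (g t) < \<delta> \<longrightarrow> dist s t \<le> e * dist (g s) (g t)"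
    and S: "hausdorff1 S < \<infinity>"
  shows "negligible {t \<in> I. g t \<in> S}"
  unfolding negligible_outer_le
proof (intro allI impI)
  fix e :: real assume e: "e > 0"
  obtain M where M: "hausdorff1 S = ennreal M" "M \<ge> 0"
    using S by (cases "hausdorff1 S") auto
  then have S': "hausdorff1 S < ennreal (M + 1)" by (simp add: ennreal_lessI)
  \<comment> \<open>Chosen so that \<open>2 * K * (M + 1) = e\<close>; the added 1 makes the bound
    on \<open>hausdorff1 S\<close> strict and the denominator positive.\<close>
  define K where "K = e / (2 * (M + 1))"
  have K: "K > 0" using e M by (simp add: K_def)
  obtain \<delta> where \<delta>: "\<delta> > 0"
    "\<And>s t. s \<in> I \<Longrightarrow> t \<in> I \<Longrightarrow> dist (g s) (g t) < \<delta> \<Longrightarrow> dist s t \<le> K * dist (g s) (g t)"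
    using g[OF K] by blast
  from lebesgue_cover_vimage[OF \<delta>(2,1) less_imp_le[OF K] S']
  obtain T where "{t \<in> I. g t \<in> S} \<subseteq> T" "T \<in> lmeasurable" "measure lebesgue T \<le> 2 * K * (M + 1)"
    by blast
  moreover have "2 * K * (M + 1) = e" using M by (simp add: K_def field_simps)
  ultimately show "\<exists>T. {t \<in> I. g t \<in> S} \<subseteq> T \<and> T \<in> lmeasurable \<and> measure lebesgue T \<le> e" by auto
qed

text \<open>A Lipschitz curve on the whole line may have infinite length, so it is split into the
  images of the intervals from \<open>- N\<close> to \<open>N\<close>; countably many null preimages
  have a null union.\<close>

lemma negligible_vimage_rectifiable:
  fixes g :: "real \<Rightarrow> real^2"
  assumes g: "\<And>e. e > 0 \<Longrightarrow> \<exists>\<delta>>0. \<forall>s\<in>I. \<forall>t\<in>I. dist (g s) (g t) < \<delta> \<longrightarrow> dist s t \<le> e * dist (g s) (g t)"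
    and M: "countably_1_rectifiable M"
  shows "negligible {t \<in> I. g t \<in> M}"
proof -
  obtain M0 and F :: "nat \<Rightarrow> real \<Rightarrow> real^2" where M0: "hausdorff1 M0 = 0"
    and F: "\<And>j. \<exists>L. L-lipschitz_on UNIV (F j)" and M: "M \<subseteq> M0 \<union> (\<Union>j. range (F j))"
    using M unfolding countably_1_rectifiable_def by blast
  have "negligible {t \<in> I. g t \<in> M0}"
    by (rule negligible_vimage_finite, rule g, simp, simp add: M0)
  moreover have "negligible {t \<in> I. g t \<in> F j ` {- real N..real N}}" for j N
  proof (rule negligible_vimage_finite)
    obtain L where "L-lipschitz_on UNIV (F j)" using F by blast
    then have "L-lipschitz_on {- real N..real N} (F j)" by (rule lipschitz_on_subset) simp
    then have "hausdorff1 (F j ` {- real N..real N}) \<le> ennreal (L * (real N - (- real N)))"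
      by (rule hausdorff1_lipschitz_image_le) simp
    then show "hausdorff1 (F j ` {- real N..real N}) < \<infinity>"
      by (rule le_less_trans) simp
  qed (rule g)
  ultimately have neg: "negligible ({t \<in> I. g t \<in> M0} \<union>
      (\<Union>j. \<Union>N. {t \<in> I. g t \<in> F j ` {- real N..real N}}))"
    by (intro negligible_Un negligible_countable_Union countable_image) auto
  have "t \<in> {t \<in> I. g t \<in> M0} \<union> (\<Union>j. \<Union>N. {t \<in> I. g t \<in> F j ` {- real N..real N}})"
    if t: "t \<in> I" "g t \<in> M" for t
  proof (cases "g t \<in> M0")
    case False
    then obtain j x where x: "g t = F j x" using M t by blast
    obtain N :: nat where "\<bar>x\<bar> \<le> real N" using real_arch_simple by blast
    then have "g t \<in> F j ` {- real N..real N}" using x by (auto simp: abs_le_iff)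
    then show ?thesis using t by blast
  qed (use t in blast)
  then show ?thesis by (intro negligible_subset[OF neg]) blast
qed

section \<open>Isosceles triangles and cones\<close>

text \<open>Equal legs mean that \<open>c\<close> projects onto the midpoint of the base, which
  comes out of expanding the squared distances.\<close>

lemma equidistant_inner:
  fixes p q c :: "'a::real_inner"
  assumes "dist p c = dist q c"
  shows "(q - p) \<bullet> (c - p) = (dist p q)\<^sup>2 / 2"
proof -
  have "(p - c) \<bullet> (p - c) = (q - c) \<bullet> (q - c)"
    using assms by (simp add: dist_norm norm_eq_sqrt_inner)
  then show ?thesis
    by (simp add: dist_norm power2_norm_eq_inner inner_diff_left inner_diff_right inner_commute algebra_simps)
qed

text \<open>By that projection the cosine of the base angle is half the base over the leg;
  Cauchy-Schwarz keeps the argument of \<open>arccos\<close> in its domain.\<close>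

lemma cap_apex_dist:
  assumes "cap_apex p q \<alpha> c"
  shows "dist p q > 0" "dist p q = 2 * cos \<alpha> * dist p c"
proof -
  have nc: "\<not> collinear {p, q, c}" and d: "dist p c = dist q c"
    and a: "angle_between (q - p) (c - p) = \<alpha>"
    using assms by (auto simp: cap_apex_def)
  have pq: "p \<noteq> q" using nc by (auto simp: insert_commute)
  then show "dist p q > 0" by simp
  have pc: "p \<noteq> c" using nc by (auto simp: insert_commute)
  define y where "y = (q - p) \<bullet> (c - p) / (norm (q - p) * norm (c - p))"
  have "\<bar>y\<bar> \<le> 1" using Cauchy_Schwarz_ineq2[of "q - p" "c - p"] pq pc
    by (simp add: y_def abs_mult)
  then have "cos \<alpha> = y" using a unfolding angle_between_def y_def[symmetric] by (metis cos_arccos_abs)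
  also have "y = dist p q / (2 * dist p c)"
    using equidistant_inner[OF d] pq pc
    by (simp add: y_def dist_norm norm_minus_commute power2_eq_square field_simps)
  finally show "dist p q = 2 * cos \<alpha> * dist p c" using pc by (simp add: field_simps)
qed

text \<open>Applied to a base \<open>v\<close> almost parallel to \<open>u\<close> and a flat isosceles triangle with sides \<open>w\<close> and
  \<open>w - v\<close>: the cosine of the base angle is at least \<open>0.98\<close>, and \<open>1 / (2 \<cdot> 0.98) < 0.52\<close>.\<close>

lemma equidistant_cone:
  fixes u v w :: "'a::real_inner"
  assumes u: "norm u = 1" and e: "norm w = norm (w - v)" and w: "norm w \<le> 52/100 * norm v"
    and v: "v \<bullet> u \<ge> 98/100 * norm v"
  shows "w \<bullet> u \<ge> norm w / 2"
proof -
  \<comment> \<open>This is the altitude of the triangle. Its squared norm is at most (0.52^2 -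
    0.25) |v|^2 < (0.15 |v|)^2, and then 0.49 - 0.15 = 0.34 exceeds the required 0.26.\<close>
  define z where "z = w - v /\<^sub>R 2"
  have "w \<bullet> w = (w - v) \<bullet> (w - v)" using e by (simp add: norm_eq_sqrt_inner)
  then have wv: "2 * (w \<bullet> v) = v \<bullet> v"
    by (simp add: inner_diff_left inner_diff_right inner_commute)
  have "(norm z)\<^sup>2 = (norm w)\<^sup>2 - (norm v)\<^sup>2 / 4"
    using wv by (simp add: z_def power2_norm_eq_inner inner_diff_left inner_diff_right inner_commute)
  also have "\<dots> \<le> (52/100 * norm v)\<^sup>2 - (norm v)\<^sup>2 / 4"
    using w by (intro diff_mono power_mono) auto
  also have "\<dots> \<le> (15/100 * norm v)\<^sup>2" by (simp add: power_mult_distrib power2_eq_square)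
  finally have z: "norm z \<le> 15/100 * norm v" by (rule power2_le_imp_le) simp
  have "\<bar>z \<bullet> u\<bar> \<le> norm z" using Cauchy_Schwarz_ineq2[of z u] u by simp
  moreover have "w \<bullet> u = (v \<bullet> u) / 2 + z \<bullet> u" by (simp add: z_def inner_diff_left)
  ultimately show ?thesis using z v w by (simp; linarith)
qed

text \<open>The norm is convex and the inner product linear. For a unit vector \<open>u\<close> this
  is the cone of half-angle 60 degrees about \<open>u\<close> with apex \<open>C\<close>. Convexity
  reduces the inclusion of a cap to that of its three vertices.\<close>

lemma convex_cone:
  fixes C u :: "'a::real_inner"
  shows "convex {x. norm (x - C) / 2 \<le> (x - C) \<bullet> u}"
  unfolding convex_def
proof clarify
  fix x y :: 'a and a b :: real
  assume xy: "norm (x - C) / 2 \<le> (x - C) \<bullet> u" "norm (y - C) / 2 \<le> (y - C) \<bullet> u"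
    and ab: "0 \<le> a" "0 \<le> b" "a + b = 1"
  have eq: "a *\<^sub>R x + b *\<^sub>R y - C = a *\<^sub>R (x - C) + b *\<^sub>R (y - C)"
    using ab(3) by (simp add: algebra_simps flip: scaleR_add_left)
  have "norm (a *\<^sub>R (x - C) + b *\<^sub>R (y - C)) \<le> a * norm (x - C) + b * norm (y - C)"
    using ab by (metis norm_triangle_ineq norm_scaleR abs_of_nonneg)
  also have "\<dots> \<le> 2 * (a * ((x - C) \<bullet> u) + b * ((y - C) \<bullet> u))"
    using mult_left_mono[OF xy(1) ab(1)] mult_left_mono[OF xy(2) ab(2)] by simp
  finally show "norm (a *\<^sub>R x + b *\<^sub>R y - C) / 2 \<le> (a *\<^sub>R x + b *\<^sub>R y - C) \<bullet> u"
    unfolding eq by (simp add: inner_add_left)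
qed

section \<open>Angles and edge lengths of the construction\<close>

locale A_eps =
  fixes \<epsilon> :: real and \<theta> :: "nat \<Rightarrow> real" and P :: "nat \<Rightarrow> nat \<Rightarrow> real^2"
  assumes con: "A_eps_construction \<epsilon> \<theta> P"
begin

lemma apex: "i < 2 ^ n \<Longrightarrow> cap_apex (P n i) (P n (Suc i)) (\<theta> n) (P (Suc n) (2 * i + 1))"
  and P_even: "i < 2 ^ n \<Longrightarrow> P (Suc n) (2 * i) = P n i"
  and P_even': "i < 2 ^ n \<Longrightarrow> P (Suc n) (2 * i + 2) = P n (Suc i)"
  and cap_sub: "i < 2 ^ n \<Longrightarrow> cap P (Suc n) (2 * i) \<subseteq> cap P n i"
  and cap_sub': "i < 2 ^ n \<Longrightarrow> cap P (Suc n) (2 * i + 1) \<subseteq> cap P n i"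
  using con unfolding A_eps_construction_def by blast+

definition len0 :: real where "len0 = dist (P 0 0) (P 0 1)"

text \<open>The factor by which the stage \<open>n\<close> polygonal curve is longer than the
  initial segment; the real counterpart of the partial products in \<open>Pi_tilde\<close>.\<close>

definition stretch :: "nat \<Rightarrow> real" where "stretch n = (\<Prod>k<n. inverse (cos (\<theta> k)))"

definition len :: "nat \<Rightarrow> real" where "len n = len0 * stretch n / 2 ^ n"

lemma len0_pos: "len0 > 0"
  using con by (auto simp: A_eps_construction_def len0_def)

text \<open>The height is prescribed through \<open>hausdorff1\<close> of the base, which is at most
  \<open>len0\<close> because the base is a \<open>len0\<close>-Lipschitz image of the unit
  interval.\<close>

lemma height_le: "dist (P 1 1) (midpoint (P 0 0) (P 0 1)) \<le> len0 / 100"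
proof -
  have "len0-lipschitz_on {0..1} (linepath (P 0 0) (P 0 1))"
  proof (rule lipschitz_onI)
    fix s t :: real
    have "linepath (P 0 0) (P 0 1) s - linepath (P 0 0) (P 0 1) t = (s - t) *\<^sub>R (P 0 1 - P 0 0)"
      by (simp add: linepath_def algebra_simps)
    then show "dist (linepath (P 0 0) (P 0 1) s) (linepath (P 0 0) (P 0 1) t) \<le> len0 * dist s t"
      by (simp add: dist_norm len0_def norm_minus_commute mult.commute)
  qed (use len0_pos in simp)
  from hausdorff1_lipschitz_image_le[OF this] have "hausdorff1 (seg P 0 0) \<le> ennreal len0"
    by (simp add: seg_def linepath_image_01)
  then have "ennreal (dist (P 1 1) (midpoint (P 0 0) (P 0 1))) \<le> ennreal \<epsilon> * ennreal len0"
    using con by (auto simp: A_eps_construction_def intro: mult_left_mono)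
  then have "ennreal (dist (P 1 1) (midpoint (P 0 0) (P 0 1))) \<le> ennreal (\<epsilon> * len0)"
    using con len0_pos by (simp add: A_eps_construction_def ennreal_mult)
  then have "dist (P 1 1) (midpoint (P 0 0) (P 0 1)) \<le> \<epsilon> * len0"
    using con len0_pos by (subst (asm) ennreal_le_iff) (auto simp: A_eps_construction_def)
  also have "\<dots> \<le> 1/100 * len0" using con len0_pos
    by (intro mult_right_mono) (auto simp: A_eps_construction_def)
  finally show ?thesis by simp
qed

text \<open>The leg of the first cap is at most half the base plus the height, that is
  \<open>51/100 * len0\<close>, so \<open>cos (\<theta> 0)\<close> is at least 1/1.02. The later
  angles are smaller, and \<open>cos\<close> decreases up to \<open>pi\<close>, which bounds
  \<open>\<theta> 0\<close> as a value of \<open>arccos\<close>.\<close>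

lemma cos_ge: "98/100 \<le> cos (\<theta> n)"
proof -
  have a: "cap_apex (P 0 0) (P 0 1) (\<theta> 0) (P 1 1)" using apex[of 0 0] by simp
  have "dist (P 0 0) (midpoint (P 0 0) (P 0 1)) = len0 / 2"
    by (simp add: len0_def dist_midpoint)
  then have d: "dist (P 0 0) (P 1 1) \<le> 51/100 * len0"
    using height_le dist_triangle[of "P 0 0" "P 1 1" "midpoint (P 0 0) (P 0 1)"]
    by (simp add: dist_commute)
  have l: "len0 = 2 * cos (\<theta> 0) * dist (P 0 0) (P 1 1)"
    using cap_apex_dist(2)[OF a] by (simp add: len0_def)
  \<comment> \<open>Positivity has to come first, since the bound on the leg is multiplied by this
    cosine.\<close>
  have "cos (\<theta> 0) > 0"
  proof (rule ccontr)
    assume "\<not> cos (\<theta> 0) > 0"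
    then have "cos (\<theta> 0) * dist (P 0 0) (P 1 1) \<le> 0" by (simp add: mult_nonpos_nonneg)
    then show False using l len0_pos by simp
  qed
  then have "cos (\<theta> 0) * dist (P 0 0) (P 1 1) \<le> cos (\<theta> 0) * (51/100 * len0)"
    using d by (intro mult_left_mono) auto
  then have "1 * len0 \<le> (cos (\<theta> 0) * (102/100)) * len0" using l by (simp add: algebra_simps)
  then have c0: "98/100 \<le> cos (\<theta> 0)" using len0_pos by (simp only: mult_le_cancel_right) simp
  have mono: "\<theta> n \<le> \<theta> 0" by (induct n) (use con in \<open>auto simp: A_eps_construction_def intro: order_trans\<close>)
  have "\<theta> 0 = angle_between (P 0 1 - P 0 0) (P 1 1 - P 0 0)" using a by (simp add: cap_apex_def)
  moreover have "\<bar>(P 0 1 - P 0 0) \<bullet> (P 1 1 - P 0 0) / (norm (P 0 1 - P 0 0) * norm (P 1 1 - P 0 0))\<bar> \<le> 1"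
    using Cauchy_Schwarz_ineq2[of "P 0 1 - P 0 0" "P 1 1 - P 0 0"] by (auto simp: abs_mult divide_le_eq_1 not_less)
  ultimately have "\<theta> 0 \<le> pi" unfolding angle_between_def
    by (metis abs_le_iff arccos_ubound minus_le_iff)
  then have "cos (\<theta> 0) \<le> cos (\<theta> n)" using mono con
    by (intro cos_monotone_0_pi_le) (auto simp: A_eps_construction_def less_imp_le)
  then show ?thesis using c0 by simp
qed

text \<open>Both legs of a cap equal its base divided by \<open>2 * cos (\<theta> n)\<close>, so
  equality of all lengths passes from stage to stage.\<close>

lemma edge_length:
  assumes "i < 2 ^ n"
  shows "dist (P n i) (P n (Suc i)) = len n"
  using assms
proof (induct n arbitrary: i)
  case 0
  then show ?case by (simp add: len_def stretch_def len0_def)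
next
  case (Suc n)
  define j where "j = i div 2"
  have j: "j < 2 ^ n" using Suc.prems by (simp add: j_def)
  note a = apex[OF j]
  have "dist (P n j) (P (Suc n) (2 * j + 1)) = len n / (2 * cos (\<theta> n))"
    using cap_apex_dist(2)[OF a] Suc.hyps[OF j] cos_ge[of n] by (simp add: field_simps)
  also have "\<dots> = len (Suc n)" by (simp add: len_def stretch_def field_simps)
  finally have d: "dist (P n j) (P (Suc n) (2 * j + 1)) = len (Suc n)" .
  then have d': "dist (P n (Suc j)) (P (Suc n) (2 * j + 1)) = len (Suc n)"
    using a by (simp add: cap_apex_def)
  show ?case
  proof (cases "even i")
    case True
    then have "i = 2 * j" by (simp add: j_def)
    then show ?thesis using d P_even[OF j] by simp
  next
    case False
    then have i: "i = 2 * j + 1" by (simp add: j_def)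
    have "P (Suc n) (Suc i) = P n (Suc j)" using P_even'[OF j] i by simp
    then show ?thesis using d' i by (simp add: dist_commute)
  qed
qed

lemma stretch_ge: "1 \<le> stretch n" and stretch_pos: "0 < stretch n" and stretch_mono: "m \<le> n \<Longrightarrow> stretch m \<le> stretch n"
proof -
  have c: "1 \<le> inverse (cos (\<theta> k))" for k
    using cos_ge[of k] by (intro one_le_inverse) (auto intro: less_le_trans[OF _ cos_ge])
  show g: "1 \<le> stretch n" unfolding stretch_def by (rule prod_ge_1) (use c in auto)
  then show "0 < stretch n" by simp
  have "stretch n \<le> stretch (Suc n)" for n
    using c[of n] g unfolding stretch_def
    by (simp add: mult_le_cancel_left1) (smt (verit) c prod_nonneg)
  then show "m \<le> n \<Longrightarrow> stretch m \<le> stretch n" by (rule lift_Suc_mono_le)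
qed

lemma len_pos: "len n > 0"
  using len0_pos stretch_pos by (simp add: len_def)

text \<open>The factor 0.52 gives geometric decay of \<open>len\<close>, and it is the ratio of leg
  to base that \<open>equidistant_cone\<close> asks for.\<close>

lemma len_Suc: "len (Suc n) \<le> 52/100 * len n"
proof -
  have c: "inverse (cos (\<theta> n)) \<le> 104/100"
    using cos_ge[of n] by (simp add: field_simps)
  have "len (Suc n) = inverse (cos (\<theta> n)) / 2 * len n" by (simp add: len_def stretch_def)
  also have "\<dots> \<le> 52/100 * len n" using c len_pos[of n] by (intro mult_right_mono) auto
  finally show ?thesis .
qed

lemma len_Suc_le: "len (Suc n) \<le> len n"
  using len_Suc[of n] len_pos[of n] by simp

lemma len_tendsto_0: "len \<longlonglongrightarrow> 0"
proof (rule real_tendsto_sandwich[OF _ _ tendsto_const])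
  have "len n \<le> len0 * (52/100) ^ n" for n
  proof (induct n)
    case 0
    then show ?case by (simp add: len_def stretch_def)
  next
    case (Suc n)
    then show ?case using len_Suc[of n] by simp
  qed
  then show "\<forall>\<^sub>F n in sequentially. len n \<le> len0 * (52/100) ^ n" by simp
  show "(\<lambda>n. len0 * (52/100) ^ n) \<longlonglongrightarrow> 0"
    by (rule tendsto_mult_right_zero, rule LIMSEQ_realpow_zero) auto
  show "\<forall>\<^sub>F n in sequentially. 0 \<le> len n" using len_pos by (simp add: less_imp_le)
qed

section \<open>Nesting and separation of caps\<close>

lemma cap_parent:
  assumes "j < 2 ^ Suc n"
  shows "cap P (Suc n) j \<subseteq> cap P n (j div 2)"
proof -
  have "j div 2 < 2 ^ n" using assms by simp
  then show ?thesis using cap_sub[of "j div 2" n] cap_sub'[of "j div 2" n]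
    by (cases "even j") auto
qed

lemma vertex_in_cap: "P n i \<in> cap P n i" "P n (Suc i) \<in> cap P n i"
  by (auto simp: cap_def hull_inc)

text \<open>Vertices of a cap are within \<open>len n\<close> of each other. Balls are convex, so
  the ball about a vertex contains the cap; hence the ball about any point of the cap contains the
  vertices and, by convexity again, the cap.\<close>

lemma cap_dist_le:
  assumes i: "i < 2 ^ n" and xy: "x \<in> cap P n i" "y \<in> cap P n i"
  shows "dist x y \<le> len n"
proof -
  let ?S = "{P n i, P n (Suc i), P (Suc n) (2 * i + 1)}"
  have "dist a b \<le> len n" if "a \<in> ?S" "b \<in> ?S" for a b
  proof -
    have "2 * i < 2 ^ Suc n" using i by simp
    then have d: "dist (P n i) (P (Suc n) (2 * i + 1)) = len (Suc n)"
      using edge_length[of "2 * i" "Suc n"] P_even[OF i] by simp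
    then have "dist (P n (Suc i)) (P (Suc n) (2 * i + 1)) = len (Suc n)"
      using apex[OF i] by (simp add: cap_apex_def)
    then show ?thesis using d that edge_length[OF i] len_Suc_le[of n] len_pos[of n]
      by (auto simp: dist_commute)
  qed
  then have "?S \<subseteq> cball a (len n)" if "a \<in> ?S" for a using that by auto
  then have "cap P n i \<subseteq> cball a (len n)" if "a \<in> ?S" for a
    unfolding cap_def using that by (intro hull_minimal convex_cball)
  then have "?S \<subseteq> cball x (len n)" using xy(1) by (force simp: dist_commute)
  then have "cap P n i \<subseteq> cball x (len n)"
    unfolding cap_def by (intro hull_minimal convex_cball)
  then show ?thesis using xy(2) by auto
qed

text \<open>The two caps lie in opposite cones with apex \<open>V\<close> and axis \<open>u\<close>,
  the direction of the parent's base. Along \<open>u\<close>, each point is at least half its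
  distance from \<open>V\<close> away from \<open>V\<close>, on opposite sides, and these advances
  add up.\<close>

lemma siblings_separated:
  assumes i: "i < 2 ^ n" and x: "x \<in> cap P (Suc n) (2 * i)" and y: "y \<in> cap P (Suc n) (2 * i + 1)"
  defines "V \<equiv> P (Suc n) (2 * i + 1)"
  shows "(dist x V + dist y V) / 2 \<le> dist x y"
proof -
  define p q where "p = P n i" and "q = P n (Suc i)"
  note a = apex[OF i, folded V_def p_def q_def]
  have pV: "dist p V = len (Suc n)" "dist q V = len (Suc n)"
    using edge_length[of "2 * i" "Suc n"] P_even[OF i] a i by (simp_all add: V_def p_def cap_apex_def)
  have pq: "dist p q = len n" using edge_length[OF i] by (simp add: p_def q_def)
  define u where "u = (q - p) /\<^sub>R len n"
  have u: "norm u = 1" using pq len_pos[of n] by (simp add: u_def dist_norm norm_minus_commute)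
  have l: "len n = 2 * cos (\<theta> n) * len (Suc n)" using cap_apex_dist(2)[OF a] pq pV by simp
  have half: "len n / 2 \<ge> 98/100 * len (Suc n)"
    using mult_right_mono[OF cos_ge[of n] less_imp_le[OF len_pos[of "Suc n"]]] l by simp
  have "(q - p) \<bullet> (V - p) = (len n)\<^sup>2 / 2" "(p - q) \<bullet> (V - q) = (len n)\<^sup>2 / 2"
    using equidistant_inner[of p V q] equidistant_inner[of q V p] pV pq by (simp_all add: dist_commute)
  moreover have dot: "z \<bullet> u = (q - p) \<bullet> z / len n" for z
    unfolding u_def by (metis inner_scaleR_right inner_commute divide_inverse mult.commute)
  moreover have "(p - q) \<bullet> (V - q) = (q - p) \<bullet> (q - V)"
    by (simp add: inner_diff_left inner_diff_right)
  ultimately have "(V - p) \<bullet> u = len n / 2" "(q - V) \<bullet> u = len n / 2"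
    using len_pos[of n] unfolding dot by (simp_all add: power2_eq_square)
  then have Vp: "(V - p) \<bullet> u \<ge> 98/100 * norm (V - p)" and qV: "(q - V) \<bullet> u \<ge> 98/100 * norm (q - V)"
    using half pV by (simp_all add: dist_norm norm_minus_commute)
  \<comment> \<open>The vertex of a child cap off the polygonal curve is the delicate one:
    \<open>z\<close> is the far end of that cap's base, \<open>b\<close> its apex, \<open>w\<close>
    the axis of the cone.\<close>
  have third: "norm (b - V) / 2 \<le> (b - V) \<bullet> w"
    if "norm w = 1" "dist V b = len (Suc (Suc n))" "dist z b = len (Suc (Suc n))"
      "norm (z - V) = len (Suc n)" "(z - V) \<bullet> w \<ge> 98/100 * norm (z - V)" for b z w
    using that len_Suc[of "Suc n"]
    by (intro equidistant_cone[of w "b - V" "z - V"]) (simp_all add: dist_norm norm_minus_commute)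
  have child: "dist (P (Suc n) k) (P (Suc (Suc n)) (2 * k + 1)) = len (Suc (Suc n))"
    "dist (P (Suc n) (Suc k)) (P (Suc (Suc n)) (2 * k + 1)) = len (Suc (Suc n))" if "k < 2 ^ Suc n" for k
    using edge_length[of "2 * k" "Suc (Suc n)"] P_even[OF that] apex[OF that] that
    by (simp_all add: cap_apex_def)
  have "cap P (Suc n) (2 * i) \<subseteq> {x. norm (x - V) / 2 \<le> (x - V) \<bullet> (- u)}"
    unfolding cap_def
  proof (intro hull_minimal convex_cone)
    have "norm (p - V) / 2 \<le> (p - V) \<bullet> (- u)"
      using Vp norm_ge_zero[of "V - p"] by (simp add: inner_diff_left norm_minus_commute; linarith)
    moreover have "norm (P (Suc (Suc n)) (2 * (2 * i) + 1) - V) / 2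
        \<le> (P (Suc (Suc n)) (2 * (2 * i) + 1) - V) \<bullet> (- u)"
      using child[of "2 * i"] i u pV Vp P_even[OF i]
      by (intro third[of _ _ p]) (simp_all add: V_def p_def dist_norm norm_minus_commute inner_diff_left)
    ultimately show "{P (Suc n) (2 * i), P (Suc n) (Suc (2 * i)), P (Suc (Suc n)) (2 * (2 * i) + 1)}
        \<subseteq> {x. norm (x - V) / 2 \<le> (x - V) \<bullet> (- u)}"
      using P_even[OF i] by (simp add: p_def V_def)
  qed
  then have 1: "norm (x - V) / 2 \<le> (V - x) \<bullet> u" using x by (auto simp: inner_diff_left)
  have "cap P (Suc n) (2 * i + 1) \<subseteq> {x. norm (x - V) / 2 \<le> (x - V) \<bullet> u}"
    unfolding cap_def
  proof (intro hull_minimal convex_cone)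
    have "norm (q - V) / 2 \<le> (q - V) \<bullet> u"
      using qV norm_ge_zero[of "q - V"] by linarith
    moreover have "norm (P (Suc (Suc n)) (2 * (2 * i + 1) + 1) - V) / 2
        \<le> (P (Suc (Suc n)) (2 * (2 * i + 1) + 1) - V) \<bullet> u"
      using child[of "2 * i + 1"] i u pV qV P_even'[OF i]
      by (intro third[of _ _ q]) (simp_all add: V_def q_def dist_norm norm_minus_commute)
    ultimately show "{P (Suc n) (2 * i + 1), P (Suc n) (Suc (2 * i + 1)), P (Suc (Suc n)) (2 * (2 * i + 1) + 1)}
        \<subseteq> {x. norm (x - V) / 2 \<le> (x - V) \<bullet> u}"
      using P_even'[OF i] by (simp add: q_def V_def)
  qed
  then have 2: "norm (y - V) / 2 \<le> (y - V) \<bullet> u" using y by auto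
  have "(norm (x - V) + norm (y - V)) / 2 \<le> (y - x) \<bullet> u"
    using 1 2 by (simp add: inner_diff_left field_simps)
  also have "\<dots> \<le> norm (y - x)" using Cauchy_Schwarz_ineq2[of "y - x" u] u by simp
  finally show ?thesis by (simp add: dist_norm norm_minus_commute)
qed

text \<open>For even \<open>i\<close> the caps are siblings. For odd \<open>i\<close> they lie in
  neighbouring parents that meet at the same vertex, so the estimate is inherited from the previous
  stage.\<close>

lemma neighbours_separated:
  assumes "Suc i < 2 ^ n" "x \<in> cap P n i" "y \<in> cap P n (Suc i)"
  shows "(dist x (P n (Suc i)) + dist y (P n (Suc i))) / 2 \<le> dist x y"
  using assms
proof (induct n arbitrary: i)
  case 0
  then show ?case by simp
next
  case (Suc n)
  define j where "j = i div 2"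
  show ?case
  proof (cases "even i")
    case True
    then have "i = 2 * j" by (simp add: j_def)
    then show ?thesis using siblings_separated[of j n x y] Suc.prems by simp
  next
    case False
    then have i: "i = 2 * j + 1" by (simp add: j_def)
    then have j: "Suc j < 2 ^ n" using Suc.prems(1) by simp
    have "x \<in> cap P n j" "y \<in> cap P n (Suc j)"
      using Suc.prems cap_parent[of i n] cap_parent[of "Suc i" n] i by auto
    moreover have "P (Suc n) (Suc i) = P n (Suc j)" using P_even'[of j n] j i by simp
    ultimately show ?thesis using Suc.hyps[OF j] by simp
  qed
qed

text \<open>If the parents are not neighbours, induction applies. Otherwise they share a vertex, and
  one of the two caps is the child away from it: it keeps distance \<open>len / 2\<close> from that
  vertex, and separation of the parents costs another factor 2.\<close>

lemma caps_separated:
  assumes "i + 2 \<le> j" "j < 2 ^ n" "x \<in> cap P n i" "y \<in> cap P n j"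
  shows "len n / 4 \<le> dist x y"
  using assms
proof (induct n arbitrary: i j)
  case 0
  then show ?case by simp
next
  case (Suc n)
  define i' j' where "i' = i div 2" and "j' = j div 2"
  have j': "j' < 2 ^ n" using Suc.prems by (simp add: j'_def)
  have x: "x \<in> cap P n i'" and y: "y \<in> cap P n j'"
    using Suc.prems cap_parent[of i n] cap_parent[of j n] by (auto simp: i'_def j'_def)
  have "i' < j'" using Suc.prems(1) unfolding i'_def j'_def by linarith
  then consider "i' + 2 \<le> j'" | "j' = Suc i'" by linarith
  then show ?case
  proof cases
    case 1
    then show ?thesis using Suc.hyps[OF 1 j' x y] len_Suc_le[of n] by simp
  next
    case 2
    have i': "i' < 2 ^ n" using 2 j' by simp
    have sep: "(dist x (P n j') + dist y (P n j')) / 2 \<le> dist x y"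
      using neighbours_separated[of i' n x y] x y j' 2 by simp
    have half_sum: "(a + l) / 2 \<le> d \<Longrightarrow> 0 \<le> a \<Longrightarrow> l / 2 \<le> d" for a l d :: real by simp
    have quarter: "l / 2 \<le> a \<Longrightarrow> (a + b) / 2 \<le> d \<Longrightarrow> 0 \<le> b \<Longrightarrow> l / 4 \<le> d" for a b l d :: real by simp
    \<comment> \<open>Otherwise both caps would be the inner children, hence adjacent.\<close>
    have "i = 2 * i' \<or> j = 2 * j' + 1"
      using Suc.prems(1) 2 unfolding i'_def j'_def by presburger
    then show ?thesis
    proof
      assume i: "i = 2 * i'"
      \<comment> \<open>The shared vertex belongs to the sibling of cap \<open>i\<close>, so
        \<open>siblings_separated\<close> applies to it and \<open>x\<close>.\<close>
      have q: "P n j' = P (Suc n) (Suc (2 * i' + 1))" using P_even'[OF i'] 2 by simp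
      have "(dist x (P (Suc n) (2 * i' + 1)) + dist (P n j') (P (Suc n) (2 * i' + 1))) / 2 \<le> dist x (P n j')"
        using siblings_separated[OF i', of x "P n j'"] Suc.prems(3) i vertex_in_cap(2)[of "Suc n" "2 * i' + 1"] q
        by simp
      moreover have "dist (P n j') (P (Suc n) (2 * i' + 1)) = len (Suc n)"
        using edge_length[of "2 * i' + 1" "Suc n"] i' q by (simp add: dist_commute)
      ultimately have "len (Suc n) / 2 \<le> dist x (P n j')"
        using half_sum[OF _ zero_le_dist] by metis
      then show ?thesis using quarter[OF _ sep zero_le_dist] by simp
    next
      assume j: "j = 2 * j' + 1"
      have q: "P n j' = P (Suc n) (2 * j')" using P_even[OF j'] by simp
      have "(dist (P n j') (P (Suc n) (2 * j' + 1)) + dist y (P (Suc n) (2 * j' + 1))) / 2 \<le> dist (P n j') y"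
        using siblings_separated[OF j', of "P n j'" y] Suc.prems(4) j vertex_in_cap(1)[of "Suc n" "2 * j'"] q
        by simp
      moreover have "dist (P n j') (P (Suc n) (2 * j' + 1)) = len (Suc n)"
        using edge_length[of "2 * j'" "Suc n"] j' q by simp
      ultimately have "len (Suc n) / 2 \<le> dist y (P n j')"
        using half_sum[OF _ zero_le_dist] by (metis add.commute dist_commute)
      then show ?thesis using quarter[OF _ _ zero_le_dist] sep by (metis add.commute)
    qed
  qed
qed

section \<open>The limit parametrisation and its inverse\<close>

definition base_pt :: "real \<Rightarrow> real^2" where "base_pt t = P 0 0 + t *\<^sub>R (P 0 1 - P 0 0)"

text \<open>Moving the parameter from the segment to the unit interval makes Lebesgue measure on the
  line available.\<close>

definition G :: "real \<Rightarrow> real^2" where "G t = limit_param P (base_pt t)"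

text \<open>The minimum only matters at \<open>t = 1\<close>, which belongs to the last subinterval.\<close>

definition idx :: "nat \<Rightarrow> real \<Rightarrow> nat" where "idx n t = min (2 ^ n - 1) (nat \<lfloor>2 ^ n * t\<rfloor>)"

lemma seg_eq: "seg P 0 0 = base_pt ` {0..1}"
  unfolding seg_def by (auto simp: closed_segment_def base_pt_def algebra_simps image_iff)

lemma dist_base_pt: "dist (base_pt s) (base_pt t) = len0 * dist s t"
proof -
  have "base_pt s - base_pt t = (s - t) *\<^sub>R (P 0 1 - P 0 0)"
    by (simp add: base_pt_def algebra_simps)
  then show ?thesis by (simp add: dist_norm len0_def norm_minus_commute mult.commute)
qed

lemma idx_1: "idx n 1 = 2 ^ n - 1"
  by (simp add: idx_def nat_power_eq)

lemma idx_less_1: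
  assumes "0 \<le> t" "t < 1"
  shows "idx n t = nat \<lfloor>2 ^ n * t\<rfloor>" "nat \<lfloor>2 ^ n * t\<rfloor> < 2 ^ n"
proof -
  have "2 ^ n * t < 2 ^ n" using assms by simp
  then have "\<lfloor>2 ^ n * t\<rfloor> < 2 ^ n" by (simp add: floor_less_iff)
  then show "nat \<lfloor>2 ^ n * t\<rfloor> < 2 ^ n" by (simp add: nat_less_iff assms)
  then have "nat \<lfloor>2 ^ n * t\<rfloor> \<le> 2 ^ n - 1" by linarith
  then show "idx n t = nat \<lfloor>2 ^ n * t\<rfloor>" unfolding idx_def by (rule min_absorb2)
qed

text \<open>Both real bounds are non-strict because \<open>t = 1\<close> attains the upper
  one.\<close>

lemma idx_bounds:
  assumes "t \<in> {0..1}"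
  shows "idx n t < 2 ^ n" "real (idx n t) \<le> 2 ^ n * t" "2 ^ n * t \<le> real (idx n t) + 1"
proof -
  show "idx n t < 2 ^ n" unfolding idx_def
    by (metis diff_less min.strict_coboundedI1 pos2 zero_less_one zero_less_power)
  have "real (idx n t) \<le> 2 ^ n * t \<and> 2 ^ n * t \<le> real (idx n t) + 1"
  proof (cases "t = 1")
    case True
    then show ?thesis by (simp add: idx_1 of_nat_diff)
  next
    case False
    then show ?thesis using assms by (auto simp: idx_less_1 intro: less_imp_le)
  qed
  then show "real (idx n t) \<le> 2 ^ n * t" "2 ^ n * t \<le> real (idx n t) + 1" by auto
qed

text \<open>This makes the caps selected by \<open>t\<close> a nested sequence.\<close>

lemma idx_Suc:
  assumes "t \<in> {0..1}"
  shows "idx (Suc n) t div 2 = idx n t"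
proof (cases "t = 1")
  case True
  have "(2 * m - 1) div 2 = m - 1" if "m > 0" for m :: nat using that by presburger
  from this[of "2 ^ n"] show ?thesis using True by (simp add: idx_1)
next
  case False
  then have t: "0 \<le> t" "t < 1" using assms by auto
  define i j where "i = nat \<lfloor>2 ^ n * t\<rfloor>" and "j = nat \<lfloor>2 ^ Suc n * t\<rfloor>"
  have i: "real i \<le> 2 ^ n * t" "2 ^ n * t < real i + 1" using t by (auto simp: i_def)
  have j: "real j \<le> 2 * (2 ^ n * t)" "2 * (2 ^ n * t) < real j + 1" using t by (auto simp: j_def mult.assoc)
  have "real (2 * i) < real (j + 1)" "real j < real (2 * i + 2)" using i j by auto
  then have "2 * i < j + 1" "j < 2 * i + 2" by linarith+
  then have "j div 2 = i" by presburger
  then show ?thesis using idx_less_1(1)[OF t] by (simp add: i_def j_def)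
qed

lemma param_in_cap:
  assumes t: "t \<in> {0..1}"
  shows "param P n (base_pt t) \<in> cap P n (idx n t)"
proof -
  define i u where "i = idx n t" and "u = 2 ^ n * t - real i"
  have u: "0 \<le> u" "u \<le> 1" using idx_bounds(2,3)[OF t, of n] by (auto simp: u_def i_def)
  have ne: "P 0 0 \<noteq> P 0 1" using len0_pos by (auto simp: len0_def)
  have "(1 - u) *\<^sub>R (P 0 0 + (real i / 2 ^ n) *\<^sub>R (P 0 1 - P 0 0)) +
        u *\<^sub>R (P 0 0 + (real (Suc i) / 2 ^ n) *\<^sub>R (P 0 1 - P 0 0)) = base_pt t"
    by (simp add: base_pt_def u_def vec_eq_iff field_simps)
  then have "param P n (base_pt t) = (1 - u) *\<^sub>R P n i + u *\<^sub>R P n (Suc i)"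
    using param_on_subsegment[of P u n i] ne u by simp
  also have "\<dots> \<in> cap P n i"
    unfolding cap_def using u
    by (intro convexD[OF convex_convex_hull]) (auto simp: hull_inc)
  finally show ?thesis by (simp add: i_def)
qed

lemma param_in_cap_le:
  assumes t: "t \<in> {0..1}" and "n \<le> m"
  shows "param P m (base_pt t) \<in> cap P n (idx n t)"
proof -
  have "cap P m (idx m t) \<subseteq> cap P n (idx n t)" using \<open>n \<le> m\<close>
  proof (induct m rule: dec_induct)
    case (step m)
    then show ?case using cap_parent[OF idx_bounds(1)[OF t, of "Suc m"]] idx_Suc[OF t] by simp
  qed simp
  then show ?thesis using param_in_cap[OF t] by blast
qed

text \<open>From stage \<open>n\<close> on, the approximations stay in one cap of diameter at most
  \<open>len n\<close>; so they form a Cauchy sequence, and the limit stays in each of these closed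
  caps.\<close>

lemma G_in_cap:
  assumes t: "t \<in> {0..1}"
  shows "G t \<in> cap P n (idx n t)"
proof -
  let ?p = "\<lambda>n. param P n (base_pt t)"
  have "Cauchy ?p"
  proof (rule metric_CauchyI)
    fix e :: real assume "e > 0"
    then obtain n where n: "len n < e"
      using order_tendstoD(2)[OF len_tendsto_0] by (auto simp: eventually_sequentially)
    have "dist (?p k) (?p m) < e" if "k \<ge> n" "m \<ge> n" for k m
      using cap_dist_le[OF idx_bounds(1)[OF t] param_in_cap_le[OF t that(1)] param_in_cap_le[OF t that(2)]] n
      by simp
    then show "\<exists>M. \<forall>k\<ge>M. \<forall>m\<ge>M. dist (?p k) (?p m) < e" by blast
  qed
  then have lim: "?p \<longlonglongrightarrow> G t"
    by (simp add: G_def limit_param_def Cauchy_convergent flip: convergent_LIMSEQ_iff)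
  have cl: "closed (cap P n (idx n t))"
    unfolding cap_def by (intro compact_imp_closed compact_convex_hull finite_imp_compact) auto
  show ?thesis
    by (rule Lim_in_closed_set[OF cl _ _ lim])
       (use param_in_cap_le[OF t] in \<open>auto simp: eventually_sequentially\<close>)
qed

lemma G_in_limit_set: "t \<in> {0..1} \<Longrightarrow> G t \<in> limit_set P"
  unfolding limit_set_def using G_in_cap idx_bounds(1) by blast

text \<open>By \<open>caps_separated\<close> the indices differ by at most one, so \<open>s\<close>
  and \<open>t\<close> lie in two equal or adjacent intervals of length
  \<open>1 / 2 ^ n\<close>.\<close>

lemma G_separated:
  assumes s: "s \<in> {0..1}" and t: "t \<in> {0..1}" and d: "dist (G s) (G t) < len n / 4"
  shows "dist s t \<le> 2 / 2 ^ n"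
proof -
  have "\<not> idx n s + 2 \<le> idx n t" "\<not> idx n t + 2 \<le> idx n s"
    using caps_separated[OF _ idx_bounds(1)[OF t] G_in_cap[OF s] G_in_cap[OF t], of n]
      caps_separated[OF _ idx_bounds(1)[OF s] G_in_cap[OF t] G_in_cap[OF s], of n] d
    by (auto simp: dist_commute)
  then have "\<bar>2 ^ n * s - 2 ^ n * t\<bar> \<le> 2"
    using idx_bounds(2,3)[OF s, of n] idx_bounds(2,3)[OF t, of n] by linarith
  then have "2 ^ n * \<bar>s - t\<bar> \<le> 2"
    by (metis abs_mult abs_numeral power_abs right_diff_distrib)
  then show ?thesis by (simp add: dist_real_def field_simps)
qed

lemma G_inj: "inj_on G {0..1}"
proof (rule inj_onI)
  fix s t assume st: "s \<in> {0..1}" "t \<in> {0..1}" "G s = G t"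
  have "dist s t \<le> 2 / 2 ^ n" for n
    using G_separated[OF st(1,2)] st(3) len_pos[of n] by simp
  moreover have "(\<lambda>n. 2 / 2 ^ n :: real) \<longlonglongrightarrow> 0" by (rule LIMSEQ_divide_realpow_zero) simp
  ultimately have "dist s t \<le> 0" by (intro LIMSEQ_le_const) auto
  then show "s = t" by simp
qed

text \<open>At the scale of the image distance, \<open>len\<close> is
  \<open>len0 * stretch / 2 ^ m\<close> while the parameters are only about \<open>1 / 2 ^ m\<close>
  apart; a large \<open>stretch\<close> makes the quotient small.\<close>

lemma G_inverse_small_lipschitz:
  assumes unbounded: "\<And>K. \<exists>n. K < stretch n" and e: "e > 0"
  shows "\<exists>\<delta>>0. \<forall>s\<in>{0..1}. \<forall>t\<in>{0..1}. dist (G s) (G t) < \<delta> \<longrightarrow> dist s t \<le> e * dist (G s) (G t)"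
proof -
  \<comment> \<open>From \<open>len0 * K / 2 ^ m \<le> 4 * d\<close> this value gives
    \<open>4 / 2 ^ m \<le> e * d\<close>.\<close>
  define K where "K = 16 / (len0 * e)"
  obtain k0 where k0: "K < stretch k0" using unbounded by blast
  have "dist s t \<le> e * dist (G s) (G t)"
    if st: "s \<in> {0..1}" "t \<in> {0..1}" "dist (G s) (G t) < len k0 / 4" for s t
  proof (cases "s = t")
    case False
    define d where "d = dist (G s) (G t)"
    have d: "d > 0" using G_inj st False by (auto simp: d_def inj_on_def)
    then have "\<exists>k. len k \<le> 4 * d"
      using order_tendstoD(2)[OF len_tendsto_0, of "4 * d"]
      by (auto simp: eventually_sequentially intro: less_imp_le)
    define m where "m = (LEAST k. len k \<le> 4 * d)"
    have m: "len m \<le> 4 * d" unfolding m_def by (rule LeastI_ex) fact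
    \<comment> \<open>This gives both a large \<open>stretch m\<close> and a predecessor
      \<open>k\<close>, at which \<open>G_separated\<close> still applies because \<open>m\<close>
      is least.\<close>
    have "m > k0"
    proof (rule ccontr)
      assume "\<not> m > k0"
      then have "len k0 \<le> len m" by (intro lift_Suc_antimono_le[of len, OF len_Suc_le]) auto
      then show False using m st(3) by (simp add: d_def)
    qed
    then obtain k where k: "m = Suc k" "k \<ge> k0" by (cases m) auto
    have "\<not> len k \<le> 4 * d" using not_less_Least[of k "\<lambda>k. len k \<le> 4 * d"] k by (simp add: m_def)
    then have 1: "dist s t \<le> 4 / 2 ^ m"
      using G_separated[OF st(1,2), of k] by (simp add: d_def k)
    have "K \<le> stretch m" using stretch_mono[of k0 m] k0 \<open>m > k0\<close> by simp
    then have "len0 * K / 2 ^ m \<le> len m" using len0_pos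
      unfolding len_def by (intro divide_right_mono mult_left_mono) auto
    also have "\<dots> \<le> 4 * d" by (rule m)
    finally have "4 / 2 ^ m \<le> e * d" using len0_pos e by (simp add: K_def field_simps)
    then show ?thesis using 1 by (simp add: d_def)
  qed simp
  then show ?thesis using len_pos[of k0] by (intro exI[of _ "len k0 / 4"]) auto
qed

section \<open>Rectifiability when the products are bounded\<close>

lemma vertex_dist_le:
  assumes "i + d \<le> 2 ^ n"
  shows "dist (P n i) (P n (i + d)) \<le> real d * len n"
  using assms
proof (induct d)
  case (Suc d)
  then have "dist (P n (i + d)) (P n (Suc (i + d))) = len n" by (intro edge_length) auto
  then show ?case
    using Suc dist_triangle[of "P n i" "P n (Suc (i + d))" "P n (i + d)"] by (simp add: algebra_simps)
qed simp

text \<open>The polygonal curve of stage \<open>n\<close> has speed \<open>len0 * stretch n\<close>,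
  and the error of replacing \<open>G\<close> by its vertices vanishes in the limit.\<close>

lemma G_lipschitz:
  assumes K: "\<And>n. stretch n \<le> K"
  shows "(len0 * K)-lipschitz_on {0..1} G"
proof (rule lipschitz_onI)
  have le: "dist (G s) (G t) \<le> len0 * K * dist s t" if "s \<in> {0..1}" "t \<in> {0..1}" "s \<le> t" for s t
  proof -
    \<comment> \<open>One of the three extra edge lengths comes from rounding to indices, the other
      two from the distances of \<open>G s\<close> and \<open>G t\<close> to the chosen
      vertices.\<close>
    have "dist (G s) (G t) \<le> len0 * K * (t - s + 3 / 2 ^ n)" for n
    proof -
      define i j where "i = idx n s" and "j = idx n t"
      have ij: "i < 2 ^ n" "j < 2 ^ n" "real i \<le> 2 ^ n * s" "2 ^ n * s \<le> real i + 1"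
          "real j \<le> 2 ^ n * t" "2 ^ n * t \<le> real j + 1"
        using idx_bounds that by (auto simp: i_def j_def)
      have st: "2 ^ n * s \<le> 2 ^ n * t" using that(3) by simp
      have "dist (P n i) (P n j) \<le> (2 ^ n * (t - s) + 1) * len n"
      proof (cases "i \<le> j")
        case True
        then have "dist (P n i) (P n j) \<le> real (j - i) * len n"
          using vertex_dist_le[of i "j - i" n] ij by simp
        also have "\<dots> \<le> (2 ^ n * (t - s) + 1) * len n"
          using ij True len_pos[of n] by (intro mult_right_mono) (auto simp: of_nat_diff algebra_simps)
        finally show ?thesis .
      next
        case False
        \<comment> \<open>The non-strict bounds on the indices leave only this exception.\<close>
        then have "i = Suc j" using ij st by linarith
        then have "dist (P n i) (P n j) = 1 * len n" using edge_length ij by (simp add: dist_commute)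
        also have "\<dots> \<le> (2 ^ n * (t - s) + 1) * len n"
          using that(3) len_pos[of n] by (intro mult_right_mono) auto
        finally show ?thesis .
      qed
      moreover have "dist (G s) (P n i) \<le> len n" "dist (G t) (P n j) \<le> len n"
        using cap_dist_le[OF _ G_in_cap vertex_in_cap(1)] ij that by (auto simp: i_def j_def)
      ultimately have "dist (G s) (G t) \<le> (2 ^ n * (t - s) + 3) * len n"
        using dist_triangle[of "G s" "G t" "P n i"] dist_triangle[of "P n i" "G t" "P n j"]
        by (simp add: dist_commute algebra_simps)
      also have "\<dots> = len0 * stretch n * (t - s + 3 / 2 ^ n)"
        by (simp add: len_def field_simps)
      also have "\<dots> \<le> len0 * K * (t - s + 3 / 2 ^ n)"
        using K len0_pos that(3) by (intro mult_right_mono mult_left_mono) auto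
      finally show ?thesis .
    qed
    moreover have "(\<lambda>n. len0 * K * (t - s + 3 / 2 ^ n)) \<longlonglongrightarrow> len0 * K * (t - s + 0)"
      by (intro tendsto_intros LIMSEQ_divide_realpow_zero) simp
    ultimately have "dist (G s) (G t) \<le> len0 * K * (t - s + 0)" by (intro LIMSEQ_le_const) auto
    then show ?thesis using that(3) by (simp add: dist_real_def)
  qed
  fix s t :: real assume "s \<in> {0..1}" "t \<in> {0..1}"
  then show "dist (G s) (G t) \<le> len0 * K * dist s t"
    using le[of s t] le[of t s] by (cases "s \<le> t") (auto simp: dist_commute)
next
  show "0 \<le> len0 * K" using len0_pos K[of 0] stretch_pos[of 0] by simp
qed

text \<open>The image is compact, hence closed, and every cap containing \<open>x\<close> also
  contains a value of \<open>G\<close>, so \<open>x\<close> is a limit of such values.\<close>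

lemma limit_set_subset_range:
  assumes K: "\<And>n. stretch n \<le> K"
  shows "limit_set P \<subseteq> G ` {0..1}"
proof
  fix x assume x: "x \<in> limit_set P"
  have "continuous_on {0..1} G" using G_lipschitz[OF K] by (rule lipschitz_on_continuous_on)
  then have cl: "closed (G ` {0..1})" by (intro compact_imp_closed compact_continuous_image) auto
  have "\<exists>y\<in>G ` {0..1}. dist y x < e" if "e > 0" for e
  proof -
    obtain n where n: "len n < e"
      using order_tendstoD(2)[OF len_tendsto_0 \<open>e > 0\<close>] by (auto simp: eventually_sequentially)
    obtain i where i: "i < 2 ^ n" "x \<in> cap P n i" using x by (auto simp: limit_set_def)
    \<comment> \<open>The midpoint of the interval number \<open>i\<close>, where the floor is
      unambiguous.\<close>
    define t where "t = (real i + 1/2) / 2 ^ n"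
    have "real (Suc i) \<le> real (2 ^ n)" using i(1) by (simp only: of_nat_le_iff Suc_le_eq)
    then have "real i + 1 \<le> 2 ^ n" by simp
    then have t: "0 \<le> t" "t < 1" by (auto simp: t_def field_simps)
    have "2 ^ n * t = real i + 1/2" by (simp add: t_def)
    moreover have "\<lfloor>real i + 1/2\<rfloor> = int i" by linarith
    ultimately have "idx n t = i" using idx_less_1(1)[OF t, of n] by simp
    then have "dist (G t) x \<le> len n" using cap_dist_le[OF i(1) _ i(2), of "G t"] G_in_cap[of t n] t by auto
    then show ?thesis using n t by force
  qed
  then show "x \<in> G ` {0..1}" using cl by (metis closure_approachable closure_closed)
qed

lemma rectifiable_if_bounded:
  assumes K: "\<And>n. stretch n \<le> K"
  shows "countably_1_rectifiable (limit_set P)"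
proof -
  \<comment> \<open>Clamping to the unit interval is 1-Lipschitz and extends \<open>G\<close> to the
    whole line.\<close>
  define F where "F = (\<lambda>t. G (max 0 (min 1 t)))"
  have "(len0 * K)-lipschitz_on UNIV F"
  proof (rule lipschitz_onI)
    fix s t :: real
    have "dist (F s) (F t) \<le> len0 * K * dist (max 0 (min 1 s)) (max 0 (min 1 t))"
      unfolding F_def by (rule lipschitz_onD[OF G_lipschitz[OF K]]) auto
    also have "\<dots> \<le> len0 * K * dist s t"
      using lipschitz_on_nonneg[OF G_lipschitz[OF K]] by (intro mult_left_mono) (auto simp: dist_real_def)
    finally show "dist (F s) (F t) \<le> len0 * K * dist s t" .
  qed (rule lipschitz_on_nonneg[OF G_lipschitz[OF K]])
  moreover have "limit_set P \<subseteq> range F"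
  proof -
    have "G t = F t" if "t \<in> {0..1}" for t using that by (simp add: F_def)
    then have "G ` {0..1} \<subseteq> range F" by (metis image_subsetI rangeI)
    then show ?thesis using limit_set_subset_range[OF K] by (rule order_trans[rotated])
  qed
  ultimately show ?thesis unfolding countably_1_rectifiable_def
    by (intro exI[of _ "{}"] exI[of _ "\<lambda>_. F"]) (auto simp: hausdorff1_empty)
qed

section \<open>The infinite product and the preimage of \<open>A\<close>\<close>

lemma Pi_tilde_eq: "Pi_tilde \<theta> x = (SUP n. ennreal (stretch n))"
proof -
  have "(\<Prod>k<n. ennreal (inverse (cos (\<theta> k)))) = ennreal (stretch n)" for n
  proof -
    have "0 \<le> inverse (cos (\<theta> k))" for k using cos_ge[of k] by simp
    then show ?thesis by (simp add: stretch_def prod_ennreal)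
  qed
  moreover have "(\<lambda>n. ennreal (stretch n)) \<longlonglongrightarrow> (SUP n. ennreal (stretch n))"
    by (intro LIMSEQ_SUP incseq_SucI ennreal_leI stretch_mono) simp
  ultimately show ?thesis unfolding Pi_tilde_def by (simp add: limI)
qed

lemma Pi_tilde_infinite_iff: "Pi_tilde \<theta> x = \<infinity> \<longleftrightarrow> (\<forall>K. \<exists>n. K < stretch n)"
proof
  assume inf: "Pi_tilde \<theta> x = \<infinity>"
  show "\<forall>K. \<exists>n. K < stretch n"
  proof (rule ccontr)
    assume "\<not> (\<forall>K. \<exists>n. K < stretch n)"
    then obtain K where "\<And>n. stretch n \<le> K" by (auto simp: not_less)
    then have "(SUP n. ennreal (stretch n)) \<le> ennreal K" by (intro SUP_least ennreal_leI)
    then show False using inf Pi_tilde_eq[of x] by (metis ennreal_neq_top infinity_ennreal_def top_unique)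
  qed
next
  assume unb: "\<forall>K. \<exists>n. K < stretch n"
  have "\<exists>n. y < ennreal (stretch n)" if "y < top" for y
  proof -
    have "y \<noteq> top" using that by simp
    then obtain r where "y = ennreal r" "r \<ge> 0" by (cases y) auto
    moreover obtain n where "r < stretch n" using unb by blast
    ultimately show ?thesis by (metis ennreal_less_iff)
  qed
  then have "(SUP n. ennreal (stretch n)) = top" by (subst SUP_eq_top_iff) auto
  then show "Pi_tilde \<theta> x = \<infinity>" by (simp add: Pi_tilde_eq)
qed

text \<open>\<open>G\<close> is injective, so only countably many parameters are sent to the
  countable vertex set; all others are sent into \<open>A\<close>.\<close>

lemma not_negligible_vimage:
  assumes A: "A \<in> {limit_set P, limit_set P - vertex_set P}"
  shows "\<not> negligible {t \<in> {0..1}. G t \<in> A}"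
proof
  assume neg: "negligible {t \<in> {0..1}. G t \<in> A}"
  have "countable (vertex_set P)" unfolding vertex_set_def by (intro countable_UN) auto
  then have "countable {t \<in> {0..1}. G t \<in> vertex_set P}"
  proof (rule countable_subset[rotated, OF countable_image])
    show "{t \<in> {0..1}. G t \<in> vertex_set P} \<subseteq> the_inv_into {0..1} G ` vertex_set P"
      using the_inv_into_f_f[OF G_inj] by (force simp: image_iff)
  qed
  then have "negligible {t \<in> {0..1}. G t \<in> vertex_set P}" unfolding negligible_iff_null_sets by (intro null_sets_completionI countable_imp_null_set_lborel)
  then have "negligible ({t \<in> {0..1}. G t \<in> A} \<union> {t \<in> {0..1}. G t \<in> vertex_set P})"
    using neg by simp
  moreover have "{0..1} \<subseteq> {t \<in> {0..1}. G t \<in> A} \<union> {t \<in> {0..1}. G t \<in> vertex_set P}"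
    using A G_in_limit_set by auto
  ultimately have "negligible {0..1::real}" by (rule negligible_subset)
  then show False using negligible_interval(1)[of 0 "1::real"] by (simp add: box_real)
qed

end

theorem corollary8p1:
  fixes \<epsilon> :: real and \<theta> :: "nat \<Rightarrow> real" and P :: "nat \<Rightarrow> nat \<Rightarrow> real^2" and A :: "(real^2) set"
  assumes "A_eps_construction \<epsilon> \<theta> P"
    and "A \<in> {limit_set P, limit_set P - vertex_set P}"
  shows "countably_1_rectifiable A \<longleftrightarrow> hausdorff1 (Lambda_inf_inv \<theta> P A) = 0"
proof -
  interpret A_eps \<epsilon> \<theta> P using assms(1) by unfold_locales
  show ?thesis
  proof (cases "\<forall>K. \<exists>n. K < stretch n")
    case True
    have "\<not> countably_1_rectifiable A"
      using negligible_vimage_rectifiable[OF G_inverse_small_lipschitz] True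
        not_negligible_vimage[OF assms(2)] by blast
    moreover have "hausdorff1 (Lambda_inf_inv \<theta> P A) \<noteq> 0"
    proof
      assume null: "hausdorff1 (Lambda_inf_inv \<theta> P A) = 0"
      \<comment> \<open>\<open>base_pt\<close> scales distances by \<open>len0\<close>, so a
        Hausdorff null set on the segment pulls back to a Lebesgue null set, here the preimage of
        \<open>A\<close> under \<open>G\<close>.\<close>
      have "negligible {t \<in> {0..1}. base_pt t \<in> Lambda_inf_inv \<theta> P A}"
      proof (rule negligible_vimage_null[OF _ _ null])
        show "dist s t \<le> inverse len0 * dist (base_pt s) (base_pt t)" for s t
          unfolding dist_base_pt using len0_pos by (simp flip: mult.assoc)
      qed (use len0_pos in simp)
      moreover have "{t \<in> {0..1}. base_pt t \<in> Lambda_inf_inv \<theta> P A} = {t \<in> {0..1}. G t \<in> A}"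
        using True by (auto simp: Lambda_inf_inv_def Lambda_inf_def seg_eq G_def Pi_tilde_infinite_iff
            simp del: infinity_ennreal_def)
      ultimately show False using not_negligible_vimage[OF assms(2)] by simp
    qed
    ultimately show ?thesis by simp
  next
    case False
    then have "Lambda_inf_inv \<theta> P A = {}"
      by (simp add: Lambda_inf_inv_def Lambda_inf_def Pi_tilde_infinite_iff del: infinity_ennreal_def)
    moreover from False obtain K where "\<And>n. stretch n \<le> K" by (auto simp: not_less)
    then have "countably_1_rectifiable (limit_set P)" by (rule rectifiable_if_bounded)
    then have "countably_1_rectifiable A"
      using assms(2) unfolding countably_1_rectifiable_def by blast
    ultimately show ?thesis by (simp add: hausdorff1_empty)
  qed
qed

end
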